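(* Let $\mathcal{A}:\mathbb{R}^{m\times n}\to\mathbb{R}^p$ be a linear map and suppose that $b=\mathcal{A}X_r+e$, where $X_r\in\mathbb{R}^{m\times n}$ is a rank-$r$ matrix and $e\in\mathbb{R}^p$. Suppose $\mathcal{A}$ has the restricted isometry property with $\delta_{3r}(\mathcal{A})\le\alpha/\sqrt{8}$, where $\alpha\in(0,1)$. Let $X^0,X^1,X^2,\ldots$ be the iterates produced by the algorithm IHTMS (Iterative Hard Thresholding with Matrix Shrinkage, defined in the context) with data $\mathcal{A},b,r$, threshold $\mu>0$ and given initial matrix $X^0\in\mathbb{R}^{m\times n}$. Then, at iteration $k$, IHTMS will recover an approximation $X^k$ satisfying $$\|X_r-X^k\|_F\le\alpha^k\|X_r-X^0\|_F+\frac{1}{1-\alpha}\left(\beta\|e\|_2+2\mu\sqrt{m}\right),$$ where $\beta:=2\sqrt{1+\alpha/\sqrt{8}}$. Furthermore, after at most $$k^*:=\left\lceil\log_{1/\alpha}\left(\|X_r-X^0\|_F/(\|e\|_2+2\mu\sqrt{m})\right)\right\rceil$$ iterations, IHTMS estimates $X_r$ with accuracy $$\|X_r-X^{k^*}\|_F\le\frac{1-\alpha+\beta}{1-\alpha}\|e\|_2+\frac{2-\alpha}{1-\alpha}\,2\mu\sqrt{m}.$$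
   Context: Throughout $m\le n$. $\|\cdot\|_F$ is the Frobenius norm on $\mathbb{R}^{m\times n}$ (with inner product $\langle X,Y\rangle=\mathrm{Tr}(X^\top Y)$), $\|\cdot\|_2$ is the Euclidean norm on $\mathbb{R}^p$, and $\mathcal{A}^*:\mathbb{R}^p\to\mathbb{R}^{m\times n}$ is the adjoint of $\mathcal{A}$. $\mathcal{A}X$ means $\mathcal{A}(X)$. Restricted isometry constant: for an integer $s$ with $1\le s\le m$, $\delta_s(\mathcal{A})$ is the minimum constant such that $(1-\delta_s(\mathcal{A}))\|X\|_F^2\le\|\mathcal{A}X\|_2^2\le(1+\delta_s(\mathcal{A}))\|X\|_F^2$ for all $X\in\mathbb{R}^{m\times n}$ with $\mathrm{rank}(X)\le s$. Best rank-$r$ approximation (hard thresholding): if $X=\sum_{i=1}^m\sigma_iu_iv_i^\top$ is the singular value decomposition of $X$ with $\sigma_1\ge\cdots\ge\sigma_m$, then $R_r(X)=\sum_{i=1}^r\sigma_iu_iv_i^\top$. Matrix shrinkage operator (soft thresholding): if $X=U\,\mathrm{Diag}(\sigma)V^\top$ is the singular value decomposition of $X$ and $\nu>0$, then $S_\nu(X)=U\,\mathrm{Diag}((\sigma-\nu)_+)V^\top$, where $a_+:=\max(a,0)$ is applied componentwise. Algorithm IHTMS: given $X^0$, $\mu>0$ and $r$, for $k=0,1,2,\ldots$ set $Y^{k+1}:=X^k-\mathcal{A}^*(\mathcal{A}X^k-b)$ and $X^{k+1}:=R_r(S_\mu(Y^{k+1}))$.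
   Formalization: The initial matrix X^0 is assumed to have rank at most r (for arbitrary X^0 both bounds can fail); r ≥ 1 and 3r ≤ m are assumed so that δ_{3r} is defined, and a negative or undefined k^* is read as 0. *)

theory Defs
  imports "HOL-Analysis.Analysis"
begin

text \<open>
  Matrices in \<open>R^{m x n}\<close> are of type \<open>real^'n^'m\<close> with \<open>m = CARD('m)\<close> and
  \<open>n = CARD('n)\<close>.  The library norm and inner product of this type are the Frobenius norm and
  the trace inner product:
\<close>

lemma inner_matrix_trace: "inner X Y = trace (transpose X ** Y)"
  for X Y :: "real^'n^'m"
  unfolding trace_def transpose_def matrix_matrix_mult_def inner_vec_def
  by (simp add: sum.swap[of _ "UNIV::'n set"])

lemma norm_matrix_frobenius: "norm X = sqrt (\<Sum>i\<in>UNIV. \<Sum>j\<in>UNIV. (X $ i $ j)\<^sup>2)"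
  for X :: "real^'n^'m"
  by (simp add: norm_eq_sqrt_inner inner_vec_def power2_eq_square)

definition is_rip_bound :: "nat \<Rightarrow> (real^'n^'m \<Rightarrow> real^'p) \<Rightarrow> real \<Rightarrow> bool" where
  "is_rip_bound s A \<delta> \<longleftrightarrow>
     (\<forall>X. rank X \<le> s \<longrightarrow>
        (1 - \<delta>) * (norm X)\<^sup>2 \<le> (norm (A X))\<^sup>2 \<and>
        (norm (A X))\<^sup>2 \<le> (1 + \<delta>) * (norm X)\<^sup>2)"

definition rip_const :: "nat \<Rightarrow> (real^'n^'m \<Rightarrow> real^'p) \<Rightarrow> real" where
  "rip_const s A = (LEAST \<delta>. is_rip_bound s A \<delta>)"

text \<open>For a linear map and \<open>s \<ge> 1\<close> the minimum exists, so \<^const>\<open>rip_const\<close> is meaningful.\<close>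

lemma rip_const_is_least:
  fixes A :: "real^'n^'m \<Rightarrow> real^'p"
  assumes "linear A" and "1 \<le> s"
  shows "is_rip_bound s A (rip_const s A)"
    and "\<And>\<delta>. is_rip_bound s A \<delta> \<Longrightarrow> rip_const s A \<le> \<delta>"
proof -
  define D where "D = Collect (is_rip_bound s A)"
  obtain B where B: "\<And>X. norm (A X) \<le> B * norm X"
    using linear_bounded[OF \<open>linear A\<close>] by blast
  have "is_rip_bound s A (1 + B\<^sup>2)"
    unfolding is_rip_bound_def
  proof (intro allI impI conjI)
    fix X :: "real^'n^'m"
    show "(1 - (1 + B\<^sup>2)) * (norm X)\<^sup>2 \<le> (norm (A X))\<^sup>2"
      using order_trans[of "- (B * norm X)\<^sup>2" 0 "(norm (A X))\<^sup>2"]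
      by (simp add: power_mult_distrib)
    have "(norm (A X))\<^sup>2 \<le> (B * norm X)\<^sup>2"
      by (intro power_mono B) simp
    also have "\<dots> \<le> (1 + (1 + B\<^sup>2)) * (norm X)\<^sup>2"
      by (simp add: power_mult_distrib algebra_simps)
    finally show "(norm (A X))\<^sup>2 \<le> (1 + (1 + B\<^sup>2)) * (norm X)\<^sup>2" .
  qed
  then have ne: "D \<noteq> {}" by (auto simp: D_def)
  have "0 \<le> \<delta>" if "is_rip_bound s A \<delta>" for \<delta>
  proof -
    define X :: "real^'n^'m" where "X = (\<chi> i j. 1)"
    have "rows X \<subseteq> span {\<chi> j. 1}"
      by (auto simp: rows_def row_def X_def intro: span_base)
    then have "rank X \<le> 1"
      unfolding row_rank_def using dim_le_card[of "rows X" "{\<chi> j. 1}"] by simp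
    moreover have "X \<noteq> 0" by (simp add: X_def vec_eq_iff)
    ultimately have "(1 - \<delta>) * (norm X)\<^sup>2 \<le> (1 + \<delta>) * (norm X)\<^sup>2" "(norm X)\<^sup>2 > 0"
      using that \<open>1 \<le> s\<close> unfolding is_rip_bound_def by (meson order_trans, simp)
    then show ?thesis by (simp add: mult_le_cancel_right)
  qed
  then have bdd: "bdd_below D" by (auto simp: D_def bdd_below_def)
  have "D = (\<Inter>X\<in>{X. rank X \<le> s}.
      {\<delta>. (1 - \<delta>) * (norm X)\<^sup>2 \<le> (norm (A X))\<^sup>2} \<inter> {\<delta>. (norm (A X))\<^sup>2 \<le> (1 + \<delta>) * (norm X)\<^sup>2})"
    by (auto simp: D_def is_rip_bound_def)
  also have "closed \<dots>"
    by (intro closed_INT ballI closed_Int closed_Collect_le continuous_intros)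
  finally have "Inf D \<in> D" using closed_contains_Inf[OF ne bdd] by blast
  moreover have "Inf D \<le> \<delta>" if "is_rip_bound s A \<delta>" for \<delta>
    using that bdd by (auto simp: D_def intro: cInf_lower)
  ultimately have "rip_const s A = Inf D"
    unfolding rip_const_def by (intro Least_equality) (auto simp: D_def)
  then show "is_rip_bound s A (rip_const s A)"
    and "\<And>\<delta>. is_rip_bound s A \<delta> \<Longrightarrow> rip_const s A \<le> \<delta>"
    using \<open>Inf D \<in> D\<close> \<open>\<And>\<delta>. is_rip_bound s A \<delta> \<Longrightarrow> Inf D \<le> \<delta>\<close> by (simp_all add: D_def)
qed

definition outer_product :: "real^'m \<Rightarrow> real^'n \<Rightarrow> real^'n^'m" where
  "outer_product u v = (\<chi> i j. u $ i * v $ j)"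

text \<open>
  \<open>X = \<Sum>i=1..m. \<sigma>\<^sub>i u\<^sub>i v\<^sub>i\<^sup>T\<close> is a singular value decomposition (in the thin form, which exists
  when \<open>m \<le> n\<close>).  Singular vectors are indexed by \<open>1, \<dots>, m\<close>, not by the type \<open>'m\<close>,
  since the ordering of the singular values matters.
\<close>

definition is_svd ::
  "(nat \<Rightarrow> real) \<Rightarrow> (nat \<Rightarrow> real^'m) \<Rightarrow> (nat \<Rightarrow> real^'n) \<Rightarrow> real^'n^'m \<Rightarrow> bool" where
  "is_svd \<sigma> u v X \<longleftrightarrow>
     (\<forall>i\<in>{1..CARD('m)}. 0 \<le> \<sigma> i) \<and>
     (\<forall>i\<in>{1..CARD('m)}. \<forall>j\<in>{1..CARD('m)}. i \<le> j \<longrightarrow> \<sigma> j \<le> \<sigma> i) \<and>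
     (\<forall>i\<in>{1..CARD('m)}. \<forall>j\<in>{1..CARD('m)}. inner (u i) (u j) = (if i = j then 1 else 0)) \<and>
     (\<forall>i\<in>{1..CARD('m)}. \<forall>j\<in>{1..CARD('m)}. inner (v i) (v j) = (if i = j then 1 else 0)) \<and>
     X = (\<Sum>i=1..CARD('m). \<sigma> i *\<^sub>R outer_product (u i) (v i))"

text \<open>
  The truncation \<open>R\<^sub>r(X)\<close> depends on the chosen decomposition when \<open>\<sigma>\<^sub>r = \<sigma>\<^sub>r\<^sub>+\<^sub>1\<close>, so it is
  rendered as a relation: \<open>Z\<close> is an admissible value of \<open>R\<^sub>r(X)\<close>.  The shrinkage \<open>S\<^sub>\<nu>(X)\<close> does
  not depend on the choice; it is rendered in the same style.
\<close>

definition hard_threshold :: "nat \<Rightarrow> real^'n^'m \<Rightarrow> real^'n^'m \<Rightarrow> bool" where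
  "hard_threshold r X Z \<longleftrightarrow>
     (\<exists>\<sigma> u v. is_svd \<sigma> u v X \<and> Z = (\<Sum>i=1..r. \<sigma> i *\<^sub>R outer_product (u i) (v i)))"

definition matrix_shrinkage :: "real \<Rightarrow> real^'n^'m \<Rightarrow> real^'n^'m \<Rightarrow> bool" where
  "matrix_shrinkage \<nu> X Z \<longleftrightarrow>
     (\<exists>\<sigma> u v. is_svd \<sigma> u v X \<and>
        Z = (\<Sum>i=1..CARD('m). max (\<sigma> i - \<nu>) 0 *\<^sub>R outer_product (u i) (v i)))"

text \<open>
  \<open>X 0, X 1, \<dots>\<close> is a run of IHTMS started at \<open>X 0\<close>, for any choice of the decompositions.
\<close>

definition ihtms_iterates ::
  "(real^'n^'m \<Rightarrow> real^'p) \<Rightarrow> real^'p \<Rightarrow> nat \<Rightarrow> real \<Rightarrow> (nat \<Rightarrow> real^'n^'m) \<Rightarrow> bool" where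
  "ihtms_iterates A b r \<mu> X \<longleftrightarrow>
     (\<forall>k. \<exists>Y S. Y = X k - adjoint A (A (X k) - b) \<and>
                matrix_shrinkage \<mu> Y S \<and> hard_threshold r S (X (Suc k)))"

end

theory Submission
  imports Defs
begin

text \<open>
  Write \<open>W\<close> for the shrunk matrix \<open>S\<^sub>\<mu>(Y\<^sup>k\<^sup>+\<^sup>1)\<close>, \<open>D = X\<^sup>k\<^sup>+\<^sup>1 - X\<^sub>r\<close> and \<open>E = X\<^sup>k - X\<^sub>r\<close>.  Since
  \<open>X\<^sup>k\<^sup>+\<^sup>1\<close> is a best approximation of \<open>W\<close> of rank at most \<open>r\<close>, it is at least as close to \<open>W\<close>
  as \<open>X\<^sub>r\<close> is, that is, \<open>\<parallel>D\<parallel>\<^sup>2 \<le> 2\<langle>D, W - X\<^sub>r\<rangle>\<close>.  The right-hand side splits into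
  \<open>2\<langle>D, W - Y\<rangle> + 2(\<langle>D, E\<rangle> - \<langle>AD, AE\<rangle>) + 2\<langle>AD, e\<rangle>\<close>.  Shrinkage moves each singular value by at
  most \<open>\<mu>\<close>, and all linear combinations of \<open>D\<close> and \<open>E\<close> have rank at most \<open>3r\<close>, so polarization of
  the restricted isometry property bounds the middle term by \<open>2\<delta>\<parallel>D\<parallel>\<parallel>E\<parallel> \<le> \<alpha>\<parallel>D\<parallel>\<parallel>E\<parallel>\<close>.
  Dividing by \<open>\<parallel>D\<parallel>\<close> gives an affine recursion for the error.
\<close>

section \<open>Orthonormal families\<close>

definition orthonormal_on :: "'i set \<Rightarrow> ('i \<Rightarrow> 'a::real_inner) \<Rightarrow> bool" where
  "orthonormal_on I f \<longleftrightarrow> (\<forall>i\<in>I. \<forall>j\<in>I. inner (f i) (f j) = (if i = j then 1 else 0))"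

lemma orthonormal_on_norm: "orthonormal_on I f \<Longrightarrow> i \<in> I \<Longrightarrow> norm (f i) = 1"
  by (simp add: orthonormal_on_def norm_eq_1)

lemma norm_sum_orthonormal:
  assumes "orthonormal_on I f" "finite I"
  shows "(norm (\<Sum>i\<in>I. c i *\<^sub>R f i))\<^sup>2 = (\<Sum>i\<in>I. (c i)\<^sup>2)"
proof -
  have "(norm (\<Sum>i\<in>I. c i *\<^sub>R f i))\<^sup>2 = (\<Sum>i\<in>I. \<Sum>j\<in>I. c i * (c j * inner (f i) (f j)))"
    by (simp add: power2_norm_eq_inner inner_sum_left inner_sum_right sum_distrib_left)
      (simp add: inner_commute mult_ac)
  also have "\<dots> = (\<Sum>i\<in>I. \<Sum>j\<in>I. if i = j then c i * c j else 0)"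
    using assms(1) by (intro sum.cong refl) (auto simp: orthonormal_on_def)
  also have "\<dots> = (\<Sum>i\<in>I. (c i)\<^sup>2)"
    using assms(2) by (simp add: power2_eq_square)
  finally show ?thesis .
qed

lemma bessel_inequality:
  assumes "orthonormal_on I f" "finite I"
  shows "(\<Sum>i\<in>I. (inner (f i) x)\<^sup>2) \<le> (norm x)\<^sup>2"
proof -
  define P where "P = (\<Sum>i\<in>I. inner (f i) x *\<^sub>R f i)"
  have "inner P x = (\<Sum>i\<in>I. (inner (f i) x)\<^sup>2)"
    by (simp add: P_def inner_sum_left power2_eq_square)
  moreover have "inner P P = (\<Sum>i\<in>I. (inner (f i) x)\<^sup>2)"
    unfolding P_def power2_norm_eq_inner[symmetric] by (rule norm_sum_orthonormal[OF assms])
  moreover have "0 \<le> inner (x - P) (x - P)" by simp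
  ultimately show ?thesis
    by (simp add: inner_diff_left inner_diff_right inner_commute power2_norm_eq_inner)
qed

section \<open>Outer products and rank\<close>

lemma vector_mult_outer_product: "x v* outer_product u v = inner u x *\<^sub>R v"
  by (simp add: vec_eq_iff outer_product_def vector_matrix_mult_def inner_vec_def
      sum_distrib_left mult_ac)

lemma outer_product_mult: "outer_product u v *v x = inner v x *\<^sub>R u"
  by (simp add: vec_eq_iff outer_product_def matrix_vector_mult_def inner_vec_def
      sum_distrib_left mult_ac)

lemma inner_outer_product: "inner W (outer_product u v) = inner (u v* W) v"
  for W :: "real^'n^'m"
  unfolding inner_vec_def outer_product_def vector_matrix_mult_def
  by (simp add: sum_distrib_left sum_distrib_right mult_ac) (rule sum.swap)

lemma matrix_sum_mult: "(\<Sum>i\<in>I. c i *\<^sub>R M i) *v x = (\<Sum>i\<in>I. c i *\<^sub>R (M i *v x))"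
  for M :: "'i \<Rightarrow> real^'n^'m"
  by (induction I rule: infinite_finite_induct)
    (simp_all add: matrix_vector_mult_add_rdistrib scaleR_matrix_vector_assoc)

lemma vector_mult_matrix_sum: "x v* (\<Sum>i\<in>I. c i *\<^sub>R M i) = (\<Sum>i\<in>I. c i *\<^sub>R (x v* M i))"
  for M :: "'i \<Rightarrow> real^'n^'m"
proof -
  have "transpose (\<Sum>i\<in>I. c i *\<^sub>R M i) = (\<Sum>i\<in>I. c i *\<^sub>R transpose (M i))"
    by (simp add: vec_eq_iff transpose_def)
  then show ?thesis
    using matrix_sum_mult[of c "\<lambda>i. transpose (M i)" I x] by (metis (no_types, lifting) sum.cong transpose_matrix_vector)
qed

lemma orthonormal_on_outer_product:
  assumes "orthonormal_on I u" "orthonormal_on I v"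
  shows "orthonormal_on I (\<lambda>i. outer_product (u i) (v i))"
  using assms
  by (auto simp: orthonormal_on_def inner_outer_product vector_mult_outer_product)

lemma rank_le_card:
  fixes M :: "real^'n^'m"
  assumes "finite B" "\<And>x. M *v x \<in> span B"
  shows "rank M \<le> card B"
  unfolding rank_dim_range using assms by (intro dim_le_card) auto

text \<open>Bases of the two ranges together span the range of the combination. The scalars are
  built in because polarization needs arbitrary combinations.\<close>

lemma rank_lincomb_le:
  fixes M N :: "real^'n^'m"
  shows "rank (a *\<^sub>R M + b *\<^sub>R N) \<le> rank M + rank N"
proof -
  obtain B where B: "independent B" "card B = rank M" "range ((*v) M) \<subseteq> span B"
    unfolding rank_dim_range by (metis basis_exists)
  obtain C where C: "independent C" "card C = rank N" "range ((*v) N) \<subseteq> span C"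
    unfolding rank_dim_range by (metis basis_exists)
  have "(a *\<^sub>R M + b *\<^sub>R N) *v x \<in> span (B \<union> C)" for x
  proof -
    have "M *v x \<in> span (B \<union> C)" "N *v x \<in> span (B \<union> C)"
      using B C span_mono[of B "B \<union> C"] span_mono[of C "B \<union> C"] by auto
    then have "a *\<^sub>R (M *v x) + b *\<^sub>R (N *v x) \<in> span (B \<union> C)"
      by (intro span_add span_mul)
    then show ?thesis
      by (simp add: matrix_vector_mult_add_rdistrib scaleR_matrix_vector_assoc)
  qed
  then have "rank (a *\<^sub>R M + b *\<^sub>R N) \<le> card (B \<union> C)"
    using B C by (intro rank_le_card) (auto dest: independent_imp_finite)
  with card_Un_le[of B C] B C show ?thesis by linarith
qed

section \<open>Best approximation by truncation\<close>

text \<open>Compare \<open>c\<close> with the indicator \<open>h\<close> of the first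
  \<open>r\<close> indices: by monotonicity \<open>(s i - s r) * (h i - c i)\<close> is never
  negative. In the sum, the part with factor \<open>s r\<close> is nonnegative, since
  \<open>h\<close> has total \<open>r\<close> and \<open>c\<close> at most \<open>r\<close>.\<close>

lemma sum_weighted_le_leading:
  fixes s c :: "nat \<Rightarrow> real"
  assumes "r \<le> m" "1 \<le> r"
    and s0: "0 \<le> s r"
    and anti: "\<And>i j. i \<in> {1..m} \<Longrightarrow> j \<in> {1..m} \<Longrightarrow> i \<le> j \<Longrightarrow> s j \<le> s i"
    and c: "\<And>i. 0 \<le> c i" "\<And>i. c i \<le> 1" "(\<Sum>i=1..m. c i) \<le> r"
  shows "(\<Sum>i=1..m. s i * c i) \<le> (\<Sum>i=1..r. s i)"
proof -
  define h where "h i = (if i \<le> r then 1 else 0 :: real)" for i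
  have h: "(\<Sum>i=1..m. g i * h i) = sum g {1..r}" for g :: "nat \<Rightarrow> real"
  proof -
    have "(\<Sum>i=1..m. g i * h i) = (\<Sum>i\<in>{1..m} \<inter> {i. i \<le> r}. g i)"
      by (subst sum.inter_restrict) (auto simp: h_def intro!: sum.cong)
    moreover have "{1..m} \<inter> {i. i \<le> r} = {1..r}" using \<open>r \<le> m\<close> by auto
    ultimately show ?thesis by simp
  qed
  have "s r * (h i - c i) \<le> s i * (h i - c i)" if "i \<in> {1..m}" for i
  proof (cases "i \<le> r")
    case True
    then show ?thesis using that anti[of i r] assms(1,2) c(2)[of i]
      by (intro mult_right_mono) (auto simp: h_def)
  next
    case False
    then show ?thesis using that anti[of r i] assms(1,2) c(1)[of i]
      by (intro mult_right_mono_neg) (auto simp: h_def)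
  qed
  then have "(\<Sum>i=1..m. s r * (h i - c i)) \<le> (\<Sum>i=1..m. s i * (h i - c i))"
    by (intro sum_mono)
  moreover have "(\<Sum>i=1..m. s r * (h i - c i)) = s r * (r - (\<Sum>i=1..m. c i))"
    using h[of "\<lambda>_. 1"] by (simp add: sum_distrib_left[symmetric] sum_subtractf)
  moreover have "0 \<le> s r * (r - (\<Sum>i=1..m. c i))"
    using s0 c(3) by simp
  ultimately show ?thesis
    using h[of s] by (simp add: right_diff_distrib sum_subtractf)
qed

lemma is_svdD:
  fixes X :: "real^'n^'m"
  assumes "is_svd \<sigma> u v X"
  shows "\<And>i. i \<in> {1..CARD('m)} \<Longrightarrow> 0 \<le> \<sigma> i"
    and "\<And>i j. i \<in> {1..CARD('m)} \<Longrightarrow> j \<in> {1..CARD('m)} \<Longrightarrow> i \<le> j \<Longrightarrow> \<sigma> j \<le> \<sigma> i"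
    and "orthonormal_on {1..CARD('m)} u" "orthonormal_on {1..CARD('m)} v"
    and "X = (\<Sum>i=1..CARD('m). \<sigma> i *\<^sub>R outer_product (u i) (v i))"
  using assms by (simp_all add: is_svd_def orthonormal_on_def)

text \<open>Each column of \<open>Q\<close> is expanded in an orthonormal basis of the range; its
  coefficient along \<open>b\<close> is an entry of \<open>b v* Q\<close>.\<close>

lemma orthonormal_basis_range:
  fixes Q :: "real^'n^'m"
  obtains B where "finite B" "card B = rank Q" "orthonormal_on B id"
    "Q = (\<Sum>b\<in>B. outer_product b (b v* Q))"
proof -
  have "subspace (range ((*v) Q))"
    by (intro linear_subspace_image subspace_UNIV matrix_vector_mul_linear)
  then obtain B where B: "pairwise orthogonal B" "\<And>x. x \<in> B \<Longrightarrow> norm x = 1"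
      "independent B" "card B = dim (range ((*v) Q))" "span B = range ((*v) Q)"
    by (metis orthonormal_basis_subspace)
  have fin: "finite B" using B(3) by (rule independent_imp_finite)
  have "Q $ i $ j = (\<Sum>b\<in>B. outer_product b (b v* Q)) $ i $ j" for i j
  proof -
    have "Q *v axis j 1 \<in> span B" using B(5) by auto
    then have "Q *v axis j 1 = (\<Sum>b\<in>B. inner (Q *v axis j 1) b *\<^sub>R b)"
      using orthonormal_basis_expand[OF B(1,2) _ fin] by metis
    moreover have "inner (Q *v axis j 1) b = (b v* Q) $ j" for b
    proof -
      have "inner (Q *v axis j 1) b = inner (axis j 1) (b v* Q)"
        by (metis dot_lmul_matrix inner_commute)
      then show ?thesis by (simp add: inner_axis')
    qed
    ultimately have "(Q *v axis j 1) $ i = (\<Sum>b\<in>B. (b v* Q) $ j * b $ i)"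
      by simp
    moreover have "(Q *v axis j 1) $ i = Q $ i $ j"
      by (simp add: matrix_vector_mult_basis column_def)
    ultimately show ?thesis by (simp add: outer_product_def mult.commute)
  qed
  then have "Q = (\<Sum>b\<in>B. outer_product b (b v* Q))" by (simp add: vec_eq_iff)
  moreover have "orthonormal_on B id"
    using B(1,2) by (auto simp: orthonormal_on_def pairwise_def orthogonal_def norm_eq_1)
  ultimately show ?thesis using that fin B(4) by (simp add: rank_dim_range)
qed

text \<open>Products of paired singular vectors are Frobenius-orthonormal. The index set is free so
  that this covers both full sums and the tail that truncation removes.\<close>

lemma norm_svd_outer_sum:
  fixes X :: "real^'n^'m"
  assumes "is_svd \<sigma> u v X" "I \<subseteq> {1..CARD('m)}"
  shows "(norm (\<Sum>i\<in>I. c i *\<^sub>R outer_product (u i) (v i)))\<^sup>2 = (\<Sum>i\<in>I. (c i)\<^sup>2)"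
proof (rule norm_sum_orthonormal)
  show "finite I" using assms(2) finite_subset by blast
  show "orthonormal_on I (\<lambda>i. outer_product (u i) (v i))"
    using orthonormal_on_outer_product[OF is_svdD(3,4)[OF assms(1)]] assms(2)
    by (auto simp: orthonormal_on_def subset_iff)
qed

text \<open>
  The Eckart-Young inequality.  Expanding \<open>Q\<close> along an orthonormal basis \<open>B\<close> of its range and
  completing the square for each basis vector leaves \<open>\<parallel>W\<parallel>\<^sup>2 - \<parallel>W - Q\<parallel>\<^sup>2 \<le> \<Sum>b\<in>B. \<parallel>W\<^sup>T b\<parallel>\<^sup>2\<close>, a
  combination of the \<open>\<sigma>\<^sub>i\<^sup>2\<close> with weights in \<open>[0,1]\<close> of total at most \<open>r\<close>.
\<close>

lemma hard_threshold_best_approximation: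
  fixes W Z Q :: "real^'n^'m"
  assumes "hard_threshold r W Z" "rank Q \<le> r" "1 \<le> r" "r \<le> CARD('m)"
  shows "norm (W - Z) \<le> norm (W - Q)"
proof -
  let ?m = "CARD('m)"
  obtain \<sigma> u v where svd: "is_svd \<sigma> u v W"
    and Z: "Z = (\<Sum>i=1..r. \<sigma> i *\<^sub>R outer_product (u i) (v i))"
    using assms(1) unfolding hard_threshold_def by blast
  note svdD = is_svdD[OF svd]
  obtain B where B: "finite B" "card B = rank Q" "orthonormal_on B id"
      "Q = (\<Sum>b\<in>B. outer_product b (b v* Q))"
    by (rule orthonormal_basis_range)
  define q where "q b = b v* Q" for b
  define w where "w b = b v* W" for b
  define c where "c i = (\<Sum>b\<in>B. (inner b (u i))\<^sup>2)" for i
  have Qq: "Q = (\<Sum>b\<in>B. outer_product b (q b))" using B(4) by (simp add: q_def)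
  have inner_Q: "inner M Q = (\<Sum>b\<in>B. inner (b v* M) (q b))" for M
    by (subst Qq) (simp add: inner_sum_right inner_outer_product)
  have w: "w b = (\<Sum>i=1..?m. (\<sigma> i * inner (u i) b) *\<^sub>R v i)" for b
    unfolding w_def
    by (subst svdD(5)) (simp add: vector_mult_matrix_sum vector_mult_outer_product)
  have norm_w: "(norm (w b))\<^sup>2 = (\<Sum>i=1..?m. (\<sigma> i)\<^sup>2 * (inner b (u i))\<^sup>2)" for b
    unfolding w by (subst norm_sum_orthonormal[OF svdD(4)])
      (simp_all add: power_mult_distrib inner_commute)
  have "(norm W)\<^sup>2 - (norm (W - Q))\<^sup>2 = 2 * inner W Q - inner Q Q"
    by (simp add: power2_norm_eq_inner inner_diff_left inner_diff_right inner_commute)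
  also have "\<dots> = (\<Sum>b\<in>B. 2 * inner (w b) (q b) - inner (q b) (q b))"
    unfolding inner_Q by (simp add: w_def q_def sum_subtractf sum_distrib_left)
  also have "\<dots> \<le> (\<Sum>b\<in>B. (norm (w b))\<^sup>2)"
  proof (rule sum_mono)
    fix b
    have "0 \<le> inner (w b - q b) (w b - q b)" by simp
    then show "2 * inner (w b) (q b) - inner (q b) (q b) \<le> (norm (w b))\<^sup>2"
      by (simp add: power2_norm_eq_inner inner_diff_left inner_diff_right inner_commute)
  qed
  also have "\<dots> = (\<Sum>i=1..?m. (\<sigma> i)\<^sup>2 * c i)"
    unfolding norm_w c_def sum_distrib_left by (rule sum.swap)
  \<comment> \<open>The comparison with the leading sum wants weights at most 1 at every index,
    while \<open>u i\<close> is arbitrary outside \<open>1..m\<close>. Inside that range the cap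
    changes nothing, by Bessel for \<open>B\<close>.\<close>
  also have "\<dots> = (\<Sum>i=1..?m. (\<sigma> i)\<^sup>2 * min (c i) 1)"
  proof (rule sum.cong[OF refl])
    fix i assume "i \<in> {1..?m}"
    then have "norm (u i) = 1" using svdD(3) by (rule orthonormal_on_norm[rotated])
    then have "c i \<le> 1" unfolding c_def using bessel_inequality[OF B(3,1), of "u i"] by simp
    then show "(\<sigma> i)\<^sup>2 * c i = (\<sigma> i)\<^sup>2 * min (c i) 1" by simp
  qed
  also have "\<dots> \<le> (\<Sum>i=1..r. (\<sigma> i)\<^sup>2)"
  proof (rule sum_weighted_le_leading[OF assms(4,3)])
    show "0 \<le> min (c i) 1" for i by (simp add: c_def sum_nonneg)
    have "(\<Sum>i=1..?m. min (c i) 1) \<le> (\<Sum>i=1..?m. c i)" by (intro sum_mono) simp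
    also have "\<dots> = (\<Sum>b\<in>B. \<Sum>i=1..?m. (inner (u i) b)\<^sup>2)"
      unfolding c_def by (subst sum.swap) (simp add: inner_commute)
    \<comment> \<open>Bessel with the roles exchanged: now \<open>u\<close> is the orthonormal
      family and \<open>b\<close> the vector.\<close>
    also have "\<dots> \<le> (\<Sum>b\<in>B. (norm b)\<^sup>2)"
      by (intro sum_mono bessel_inequality svdD) simp
    also have "\<dots> = card B" using orthonormal_on_norm[OF B(3)] by simp
    also have "\<dots> \<le> r" using B(2) assms(2) by simp
    finally show "(\<Sum>i=1..?m. min (c i) 1) \<le> r" .
    show "(\<sigma> j)\<^sup>2 \<le> (\<sigma> i)\<^sup>2" if "i \<in> {1..?m}" "j \<in> {1..?m}" "i \<le> j" for i j
      using svdD(1)[of j] svdD(2)[of i j] that by (intro power_mono) auto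
  qed auto
  finally have *: "(norm W)\<^sup>2 - (norm (W - Q))\<^sup>2 \<le> (\<Sum>i=1..r. (\<sigma> i)\<^sup>2)" .
  have split: "(\<Sum>i=1..?m. g i) = (\<Sum>i=1..r. g i) + (\<Sum>i=Suc r..?m. g i)"
    for g :: "nat \<Rightarrow> 'z::ab_group_add"
    using sum.ub_add_nat[of 1 r g "?m - r"] assms(4) by simp
  have "W - Z = (\<Sum>i=Suc r..?m. \<sigma> i *\<^sub>R outer_product (u i) (v i))"
    unfolding Z by (subst svdD(5), subst split) simp
  then have "(norm (W - Z))\<^sup>2 = (\<Sum>i=Suc r..?m. (\<sigma> i)\<^sup>2)"
    using norm_svd_outer_sum[OF svd, of "{Suc r..?m}"] by simp
  moreover have "(norm W)\<^sup>2 = (\<Sum>i=1..?m. (\<sigma> i)\<^sup>2)"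
    by (subst svdD(5)) (rule norm_svd_outer_sum[OF svd order_refl])
  ultimately have "(norm (W - Z))\<^sup>2 \<le> (norm (W - Q))\<^sup>2" using * unfolding split by simp
  then show ?thesis by (rule power2_le_imp_le) simp
qed

section \<open>Rank after truncation and error of shrinkage\<close>

lemma rank_hard_threshold:
  fixes W Z :: "real^'n^'m"
  assumes "hard_threshold r W Z"
  shows "rank Z \<le> r"
proof -
  obtain \<sigma> and u :: "nat \<Rightarrow> real^'m" and v :: "nat \<Rightarrow> real^'n"
    where Z: "Z = (\<Sum>i=1..r. \<sigma> i *\<^sub>R outer_product (u i) (v i))"
    using assms unfolding hard_threshold_def by blast
  have "rank Z \<le> card (u ` {1..r})"
    unfolding Z matrix_sum_mult outer_product_mult
    by (intro rank_le_card) (auto simp: matrix_sum_mult outer_product_mult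
        intro!: span_sum span_mul intro: span_base)
  also have "\<dots> \<le> r" using card_image_le[of "{1..r}" u] by simp
  finally show ?thesis .
qed

text \<open>A singular value \<open>\<sigma> i\<close> drops by its minimum with \<mu>, and the
  \<open>m\<close> changes sit on orthonormal outer products.\<close>

lemma norm_matrix_shrinkage_diff:
  fixes Y S :: "real^'n^'m"
  assumes "matrix_shrinkage \<mu> Y S" "0 \<le> \<mu>"
  shows "norm (S - Y) \<le> \<mu> * sqrt (real CARD('m))"
proof -
  obtain \<sigma> u v where svd: "is_svd \<sigma> u v Y"
    and S: "S = (\<Sum>i=1..CARD('m). max (\<sigma> i - \<mu>) 0 *\<^sub>R outer_product (u i) (v i))"
    using assms(1) unfolding matrix_shrinkage_def by blast
  have "S - Y = (\<Sum>i=1..CARD('m). (max (\<sigma> i - \<mu>) 0 - \<sigma> i) *\<^sub>R outer_product (u i) (v i))"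
    by (subst is_svdD(5)[OF svd]) (simp add: S sum_subtractf scaleR_left_diff_distrib)
  then have "(norm (S - Y))\<^sup>2 = (\<Sum>i=1..CARD('m). (max (\<sigma> i - \<mu>) 0 - \<sigma> i)\<^sup>2)"
    using norm_svd_outer_sum[OF svd order_refl] by simp
  also have "\<dots> \<le> (\<Sum>i=1..CARD('m). \<mu>\<^sup>2)"
    using is_svdD(1)[OF svd] assms(2)
    by (intro sum_mono) (auto simp: abs_le_square_iff[symmetric])
  also have "\<dots> = (\<mu> * sqrt (real CARD('m)))\<^sup>2" by (simp add: power_mult_distrib)
  finally show ?thesis by (rule power2_le_imp_le) (use assms(2) in simp)
qed

section \<open>Restricted isometry estimates\<close>

lemma is_rip_bound_mono:
  fixes A :: "real^'n^'m \<Rightarrow> real^'p"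
  assumes "is_rip_bound s A \<delta>" "\<delta> \<le> \<epsilon>"
  shows "is_rip_bound s A \<epsilon>"
  unfolding is_rip_bound_def
proof (intro allI impI)
  fix X :: "real^'n^'m" assume "rank X \<le> s"
  then have "(1 - \<delta>) * (norm X)\<^sup>2 \<le> (norm (A X))\<^sup>2" "(norm (A X))\<^sup>2 \<le> (1 + \<delta>) * (norm X)\<^sup>2"
    using assms(1) by (auto simp: is_rip_bound_def)
  moreover have "(1 - \<epsilon>) * (norm X)\<^sup>2 \<le> (1 - \<delta>) * (norm X)\<^sup>2"
      "(1 + \<delta>) * (norm X)\<^sup>2 \<le> (1 + \<epsilon>) * (norm X)\<^sup>2"
    using assms(2) by (auto intro: mult_right_mono)
  ultimately show "(1 - \<epsilon>) * (norm X)\<^sup>2 \<le> (norm (A X))\<^sup>2 \<and> (norm (A X))\<^sup>2 \<le> (1 + \<epsilon>) * (norm X)\<^sup>2"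
    by linarith
qed

lemma rip_norm_le:
  fixes A :: "real^'n^'m \<Rightarrow> real^'p"
  assumes "is_rip_bound s A \<delta>" "rank X \<le> s" "0 \<le> \<delta>"
  shows "norm (A X) \<le> sqrt (1 + \<delta>) * norm X"
proof (rule power2_le_imp_le)
  show "(norm (A X))\<^sup>2 \<le> (sqrt (1 + \<delta>) * norm X)\<^sup>2"
    using assms by (simp add: is_rip_bound_def power_mult_distrib)
qed (use assms(3) in simp)

text \<open>Polarization turns the left side into a difference of squared norms, estimated by the
  lower isometry bound at \<open>U + V\<close> and the upper one at \<open>U - V\<close>.\<close>

lemma rip_inner_diff_le:
  fixes A :: "real^'n^'m \<Rightarrow> real^'p"
  assumes lin: "linear A" and rip: "is_rip_bound s A \<delta>"
    and rank: "\<And>a b. rank (a *\<^sub>R D + b *\<^sub>R E) \<le> s"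
  shows "inner D E - inner (A D) (A E) \<le> \<delta> * norm D * norm E"
proof (cases "D = 0 \<or> E = 0")
  case True
  then show ?thesis using linear_0[OF lin] by auto
next
  case False
  \<comment> \<open>scaling to equal norms makes the bound from the parallelogram law sharp\<close>
  define U V where "U = norm E *\<^sub>R D" and "V = norm D *\<^sub>R E"
  have bounds: "(norm (U + V))\<^sup>2 - (norm (A (U + V)))\<^sup>2 \<le> \<delta> * (norm (U + V))\<^sup>2"
      "(norm (A (U - V)))\<^sup>2 - (norm (U - V))\<^sup>2 \<le> \<delta> * (norm (U - V))\<^sup>2"
    using rip rank[of "norm E" "norm D"] rank[of "norm E" "- norm D"]
    unfolding is_rip_bound_def U_def V_def by (auto simp: algebra_simps)
  have par: "(norm (U + V))\<^sup>2 + (norm (U - V))\<^sup>2 = 4 * (norm D * norm E)\<^sup>2"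
  proof -
    have "(norm (U + V))\<^sup>2 + (norm (U - V))\<^sup>2 = 2 * (norm U)\<^sup>2 + 2 * (norm V)\<^sup>2"
      by (simp add: power2_norm_eq_inner inner_simps inner_commute)
    then show ?thesis by (simp add: U_def V_def power_mult_distrib)
  qed
  have "4 * (inner U V - inner (A U) (A V))
      = ((norm (U + V))\<^sup>2 - (norm (A (U + V)))\<^sup>2) + ((norm (A (U - V)))\<^sup>2 - (norm (U - V))\<^sup>2)"
    by (simp add: power2_norm_eq_inner linear_add[OF lin] linear_diff[OF lin] inner_simps inner_commute)
  also have "\<dots> \<le> \<delta> * ((norm (U + V))\<^sup>2 + (norm (U - V))\<^sup>2)"
    using add_mono[OF bounds] by (simp add: distrib_left)
  finally have "inner U V - inner (A U) (A V) \<le> \<delta> * (norm D * norm E)\<^sup>2"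
    unfolding par by simp
  moreover have "inner U V - inner (A U) (A V)
      = (norm D * norm E) * (inner D E - inner (A D) (A E))"
    by (simp add: U_def V_def linear_cmul[OF lin] algebra_simps)
  ultimately have "(norm D * norm E) * (inner D E - inner (A D) (A E))
      \<le> (norm D * norm E) * (\<delta> * norm D * norm E)"
    by (simp add: power2_eq_square algebra_simps)
  then show ?thesis using False by (simp add: mult_le_cancel_left)
qed

section \<open>Error recursion\<close>

lemma ihtms_step:
  fixes A :: "real^'n^'m \<Rightarrow> real^'p" and e :: "real^'p" and Xr X X' S :: "real^'n^'m"
  assumes lin: "linear A" and rip: "is_rip_bound (3 * r) A \<delta>" and "0 \<le> \<delta>"
    and r: "1 \<le> r" "r \<le> CARD('m)" and rank: "rank Xr \<le> r" "rank X \<le> r"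
    and "0 \<le> \<mu>"
    and S: "matrix_shrinkage \<mu> (X - adjoint A (A X - (A Xr + e))) S"
    and X': "hard_threshold r S X'"
  shows "norm (Xr - X') \<le> 2 * \<delta> * norm (Xr - X)
    + (2 * sqrt (1 + \<delta>) * norm e + 2 * \<mu> * sqrt (real CARD('m)))"
proof (cases "X' = Xr")
  case True
  then show ?thesis using \<open>0 \<le> \<delta>\<close> \<open>0 \<le> \<mu>\<close> by simp
next
  case False
  define Y where "Y = X - adjoint A (A X - (A Xr + e))"
  define D E where "D = X' - Xr" and "E = X - Xr"
  have ranks: "rank (a *\<^sub>R D + b *\<^sub>R E) \<le> 3 * r" for a b
  proof -
    \<comment> \<open>Regrouping merges the two occurrences of \<open>Xr\<close>, leaving three
      matrices of rank at most \<open>r\<close>; this is the source of \<open>3 * r\<close>.\<close>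
    have "a *\<^sub>R D + b *\<^sub>R E = 1 *\<^sub>R (a *\<^sub>R X' + b *\<^sub>R X) + (- (a + b)) *\<^sub>R Xr"
      by (simp add: D_def E_def algebra_simps)
    then have "rank (a *\<^sub>R D + b *\<^sub>R E) \<le> rank (a *\<^sub>R X' + b *\<^sub>R X) + rank Xr"
      by (metis rank_lincomb_le)
    then show ?thesis
      using rank rank_lincomb_le[of a X' b X] rank_hard_threshold[OF X'] by linarith
  qed
  have "norm (S - X') \<le> norm (S - Xr)"
    by (rule hard_threshold_best_approximation[OF X' rank(1) r])
  then have "(norm (S - X'))\<^sup>2 \<le> (norm (S - Xr))\<^sup>2" by (intro power_mono) auto
  moreover have "S - X' = (S - Xr) - D" by (simp add: D_def)
  ultimately have "(norm D)\<^sup>2 \<le> 2 * inner D (S - Xr)"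
    by (simp add: power2_norm_eq_inner inner_diff_left inner_diff_right inner_commute)
  also have "inner D (S - Xr) = inner D (S - Y) + (inner D E - inner (A D) (A E)) + inner (A D) e"
  proof -
    \<comment> \<open>The residual \<open>A X - (A Xr + e)\<close> equals \<open>A E - e\<close>;
      the adjoint then moves \<open>A\<close> onto \<open>D\<close>.\<close>
    have "S - Xr = (S - Y) + (E - adjoint A (A E - e))"
      by (simp add: Y_def E_def linear_diff[OF lin] algebra_simps)
    then have "inner D (S - Xr) = inner D (S - Y) + inner D (E - adjoint A (A E - e))"
      by (simp only: inner_add_right)
    then show ?thesis
      by (simp add: inner_diff_right adjoint_works[OF lin])
  qed
  also have "inner D (S - Y) \<le> norm D * (\<mu> * sqrt (real CARD('m)))"
    using norm_matrix_shrinkage_diff[OF S[folded Y_def] \<open>0 \<le> \<mu>\<close>]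
    by (intro order_trans[OF norm_cauchy_schwarz] mult_left_mono) auto
  also have "inner D E - inner (A D) (A E) \<le> \<delta> * norm D * norm E"
    by (rule rip_inner_diff_le[OF lin rip ranks])
  also have "inner (A D) e \<le> sqrt (1 + \<delta>) * norm D * norm e"
    using rip_norm_le[OF rip, of D] ranks[of 1 0] \<open>0 \<le> \<delta>\<close>
    by (intro order_trans[OF norm_cauchy_schwarz] mult_right_mono) auto
  finally have "norm D * norm D \<le> norm D * (2 * \<delta> * norm E
      + (2 * sqrt (1 + \<delta>) * norm e + 2 * \<mu> * sqrt (real CARD('m))))"
    by (simp add: power2_eq_square algebra_simps)
  moreover have "0 < norm D" using False by (simp add: D_def)
  ultimately show ?thesis
    by (simp add: D_def E_def norm_minus_commute)
qed

text \<open>The constant \<open>c / (1 - \<alpha>)\<close> is the fixed point of the map sending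
  \<open>t\<close> to \<open>\<alpha> * t + c\<close>.\<close>

lemma affine_recursion_bound:
  fixes f :: "nat \<Rightarrow> real"
  assumes "0 \<le> \<alpha>" "\<alpha> < 1" "0 \<le> c" and step: "\<And>k. f (Suc k) \<le> \<alpha> * f k + c"
  shows "f k \<le> \<alpha> ^ k * f 0 + 1 / (1 - \<alpha>) * c"
proof (induction k)
  case 0
  then show ?case using assms by simp
next
  case (Suc k)
  have "f (Suc k) \<le> \<alpha> * (\<alpha> ^ k * f 0 + 1 / (1 - \<alpha>) * c) + c"
    using step[of k] mult_left_mono[OF Suc \<open>0 \<le> \<alpha>\<close>] by linarith
  also have "\<dots> = \<alpha> ^ Suc k * f 0 + 1 / (1 - \<alpha>) * c"
    using \<open>\<alpha> < 1\<close> by (simp add: field_simps)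
  finally show ?case .
qed

text \<open>If \<open>a < s\<close> the logarithm may be negative; \<open>nat\<close> then gives 0
  or more, still an upper bound for it. The case \<open>a = 0\<close> is separate because the
  logarithm says nothing there.\<close>

lemma power_nat_ceiling_log_mult_le:
  assumes "0 < \<alpha>" "\<alpha> < 1" "0 < s" "0 \<le> a"
  shows "\<alpha> ^ nat \<lceil>log (1 / \<alpha>) (a / s)\<rceil> * a \<le> s"
proof (cases "a = 0")
  case False
  define k where "k = nat \<lceil>log (1 / \<alpha>) (a / s)\<rceil>"
  have "log (1 / \<alpha>) (a / s) \<le> real k" unfolding k_def by linarith
  then have "a / s \<le> (1 / \<alpha>) powr real k"
    using assms False by (subst (asm) log_le_iff) auto
  then have "a / s \<le> 1 / \<alpha> ^ k"
    using assms by (simp add: powr_realpow power_one_over)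
  then show ?thesis
    unfolding k_def[symmetric] using assms by (simp add: field_simps)
qed (use assms in simp)

text \<open>The bound on \<open>rank (X 0)\<close> keeps the first step within rank
  \<open>3 * r\<close>; later iterates are truncations. The bound
  \<open>3 * r \<le> CARD('m)\<close> keeps the isometry constant in its range of
  definition.\<close>

theorem theorem5p1:
  fixes A :: "real^'n^'m \<Rightarrow> real^'p"
    and b e :: "real^'p"
    and Xr :: "real^'n^'m"
    and X :: "nat \<Rightarrow> real^'n^'m"
    and r kstar :: nat
    and \<alpha> \<beta> \<mu> :: real
  assumes "CARD('m) \<le> CARD('n)"
    and "1 \<le> r" and "3 * r \<le> CARD('m)"
    and "linear A"
    and "rank Xr = r"
    and "b = A Xr + e"
    and "0 < \<alpha>" and "\<alpha> < 1"
    and "rip_const (3 * r) A \<le> \<alpha> / sqrt 8"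
    and "0 < \<mu>"
    and "ihtms_iterates A b r \<mu> X"
    and "rank (X 0) \<le> r"
    and "\<beta> = 2 * sqrt (1 + \<alpha> / sqrt 8)"
    and "kstar = nat \<lceil>log (1 / \<alpha>) (norm (Xr - X 0) / (norm e + 2 * \<mu> * sqrt (real CARD('m))))\<rceil>"
  shows "(\<forall>k. norm (Xr - X k) \<le> \<alpha> ^ k * norm (Xr - X 0)
              + 1 / (1 - \<alpha>) * (\<beta> * norm e + 2 * \<mu> * sqrt (real CARD('m))))
       \<and> norm (Xr - X kstar) \<le> (1 - \<alpha> + \<beta>) / (1 - \<alpha>) * norm e
              + (2 - \<alpha>) / (1 - \<alpha>) * (2 * \<mu> * sqrt (real CARD('m)))"
proof -
  define \<delta> where "\<delta> = \<alpha> / sqrt 8"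
  define M where "M = 2 * \<mu> * sqrt (real CARD('m))"
  have "0 \<le> \<delta>" using \<open>0 < \<alpha>\<close> by (simp add: \<delta>_def)
  \<comment> \<open>One step contracts by \<open>2 * \<delta>\<close>, so this makes \<alpha> an
    admissible factor.\<close>
  have "2 \<le> sqrt 8" by (rule real_le_rsqrt) simp
  then have "2 * \<delta> \<le> \<alpha>" using \<open>0 < \<alpha>\<close> by (simp add: \<delta>_def field_simps)
  have M: "0 < M" using \<open>0 < \<mu>\<close> by (simp add: M_def)
  have \<beta>: "\<beta> = 2 * sqrt (1 + \<delta>)" using assms(13) by (simp add: \<delta>_def)
  have rip: "is_rip_bound (3 * r) A \<delta>"
    using is_rip_bound_mono[OF rip_const_is_least(1)[OF \<open>linear A\<close>]] assms(2,9)
    by (simp add: \<delta>_def)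
  have run: "\<exists>S. matrix_shrinkage \<mu> (X k - adjoint A (A (X k) - (A Xr + e))) S
      \<and> hard_threshold r S (X (Suc k))" for k
    using assms(11) \<open>b = A Xr + e\<close> unfolding ihtms_iterates_def by blast
  have rank: "rank (X k) \<le> r" for k
    by (cases k) (use run rank_hard_threshold assms(12) in blast)+
  have step: "norm (Xr - X (Suc k)) \<le> \<alpha> * norm (Xr - X k) + (\<beta> * norm e + M)" for k
  proof -
    obtain S where "matrix_shrinkage \<mu> (X k - adjoint A (A (X k) - (A Xr + e))) S"
        "hard_threshold r S (X (Suc k))"
      using run by blast
    then have "norm (Xr - X (Suc k)) \<le> 2 * \<delta> * norm (Xr - X k) + (\<beta> * norm e + M)"
      unfolding \<beta> M_def using assms(2,3,5,10)
      by (intro ihtms_step[OF \<open>linear A\<close> rip \<open>0 \<le> \<delta>\<close> _ _ _ rank]) auto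
    with mult_right_mono[OF \<open>2 * \<delta> \<le> \<alpha>\<close>, of "norm (Xr - X k)"] show ?thesis by simp
  qed
  have "0 \<le> \<beta> * norm e + M" using \<open>0 \<le> \<delta>\<close> M by (simp add: \<beta>)
  then have bound: "norm (Xr - X k) \<le> \<alpha> ^ k * norm (Xr - X 0) + 1 / (1 - \<alpha>) * (\<beta> * norm e + M)"
    for k
    using affine_recursion_bound[of \<alpha> "\<beta> * norm e + M" "\<lambda>k. norm (Xr - X k)"] step assms(7,8)
    by simp
  \<comment> \<open>At \<open>kstar\<close> the initial error has decayed to
    \<open>norm e + M\<close>, which adds 1 to each of the coefficients
    \<open>\<beta> / (1 - \<alpha>)\<close> and \<open>1 / (1 - \<alpha>)\<close>. Since
    \<open>M\<close> is positive, the quotient in \<open>kstar\<close> is proper even for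
    \<open>e = 0\<close>.\<close>
  have "\<alpha> ^ kstar * norm (Xr - X 0) \<le> norm e + M"
    unfolding assms(14) M_def[symmetric] using assms(7,8) M
    by (intro power_nat_ceiling_log_mult_le) (auto intro: add_nonneg_pos)
  with bound[of kstar]
  have "norm (Xr - X kstar) \<le> norm e + M + 1 / (1 - \<alpha>) * (\<beta> * norm e + M)" by linarith
  also have "\<dots> = (1 - \<alpha> + \<beta>) / (1 - \<alpha>) * norm e + (2 - \<alpha>) / (1 - \<alpha>) * M"
    using \<open>\<alpha> < 1\<close> by (simp add: divide_simps) (simp add: algebra_simps)
  finally show ?thesis using bound unfolding M_def by blast
qed

end
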